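(* For every integer $m\ge1$ there exists an explicit $K_4$-free graph $G_m$ on $20m+31$ vertices such that: (1) $\chi(G_m)=4$; (2) every proper subgraph $H\subsetneq G_m$ is $3$-colorable (in fact $2$-degenerate); (3) every cycle $C$ in $G_m$ satisfies $\operatorname{ch}_{G_m}(C)\le 10$.
   Context: For a graph $G$ and a cycle $C\subseteq G$, $\operatorname{ch}_G(C)$ is the number of edges of $G$ joining two vertices of $C$ that are not consecutive on $C$ (chords). A graph is $2$-degenerate if every nonempty subgraph has a vertex of degree at most $2$. *)

theory Defs
  imports Main
begin

type_synonym 'a ugraph = "'a set \<times> 'a set set"

abbreviation verts :: "'a ugraph \<Rightarrow> 'a set" where "verts \<equiv> fst"
abbreviation edges :: "'a ugraph \<Rightarrow> 'a set set" where "edges \<equiv> snd"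

definition finite_simple_graph :: "'a ugraph \<Rightarrow> bool" where
  "finite_simple_graph G \<longleftrightarrow>
     finite (verts G) \<and> (\<forall>e\<in>edges G. e \<subseteq> verts G \<and> card e = 2)"

text \<open>Not necessarily induced; the graph without vertices counts as a subgraph.\<close>

definition subgraph :: "'a ugraph \<Rightarrow> 'a ugraph \<Rightarrow> bool" where
  "subgraph H G \<longleftrightarrow>
     finite_simple_graph H \<and> verts H \<subseteq> verts G \<and> edges H \<subseteq> edges G"

definition proper_subgraph :: "'a ugraph \<Rightarrow> 'a ugraph \<Rightarrow> bool" where
  "proper_subgraph H G \<longleftrightarrow> subgraph H G \<and> H \<noteq> G"

definition complete_graph :: "'a ugraph \<Rightarrow> bool" where
  "complete_graph G \<longleftrightarrow> edges G = {e. e \<subseteq> verts G \<and> card e = 2}"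

definition K_free :: "nat \<Rightarrow> 'a ugraph \<Rightarrow> bool" where
  "K_free r G \<longleftrightarrow> \<not> (\<exists>H. subgraph H G \<and> complete_graph H \<and> card (verts H) = r)"

definition colorable :: "nat \<Rightarrow> 'a ugraph \<Rightarrow> bool" where
  "colorable k G \<longleftrightarrow>
     (\<exists>c. (\<forall>v\<in>verts G. c v < k) \<and> (\<forall>u v. {u, v} \<in> edges G \<longrightarrow> c u \<noteq> c v))"

definition chromatic_number :: "'a ugraph \<Rightarrow> nat" where
  "chromatic_number G = (LEAST k. colorable k G)"

definition degree :: "'a ugraph \<Rightarrow> 'a \<Rightarrow> nat" where
  "degree G v = card {e \<in> edges G. v \<in> e}"

definition degenerate :: "nat \<Rightarrow> 'a ugraph \<Rightarrow> bool" where
  "degenerate k G \<longleftrightarrow>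
     (\<forall>H. subgraph H G \<and> verts H \<noteq> {} \<longrightarrow> (\<exists>v\<in>verts H. degree H v \<le> k))"

definition cyclic_edges :: "'a list \<Rightarrow> 'a set set" where
  "cyclic_edges xs = {{xs ! i, xs ! (Suc i mod length xs)} | i. i < length xs}"

definition cycle_graph :: "'a ugraph \<Rightarrow> bool" where
  "cycle_graph C \<longleftrightarrow>
     (\<exists>xs. distinct xs \<and> length xs \<ge> 3 \<and> C = (set xs, cyclic_edges xs))"

text \<open>Two vertices of a cycle are consecutive on it iff they form one of its edges.\<close>

definition chords :: "'a ugraph \<Rightarrow> 'a ugraph \<Rightarrow> 'a set set" where
  "chords G C = {e \<in> edges G. e \<subseteq> verts C \<and> e \<notin> edges C}"

definition ch :: "'a ugraph \<Rightarrow> 'a ugraph \<Rightarrow> nat" where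
  "ch G C = card (chords G C)"

end

theory Submission
  imports Defs
begin

text \<open>Take the odd wheel with rim length \<open>2m + 3\<close> and replace every spoke by a tree of three
  triangles: a Hajos-type gadget that in every 3-colouring still separates the colours of its ends,
  with nine inner vertices. Every vertex except the hub has degree three and the graph
  without the hub is connected, so deleting anything makes the remaining graph collapse
  2-degenerately; hence all proper subgraphs are 3-colourable and there is no \<open>K\<^sub>4\<close>. A cycle uses at
  most two edges at the hub. A triangle can meet a chord only if the cycle leaves it through two of
  its exits, and following these exits outwards leads to a hub edge of the cycle. So all chords lie
  near at most two hub edges. Chords avoiding the hub are disjoint, which bounds their
  number by seven, and at most two chords contain the hub.\<close>

subsection \<open>Degeneracy and colourings\<close>

lemma subgraph_trans: "subgraph H K \<Longrightarrow> subgraph K G \<Longrightarrow> subgraph H G"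
  unfolding subgraph_def by blast

lemma degenerate_subgraph: "degenerate d G \<Longrightarrow> subgraph H G \<Longrightarrow> degenerate d H"
  unfolding degenerate_def using subgraph_trans by blast

lemma colorable_mono: "colorable k G \<Longrightarrow> k \<le> l \<Longrightarrow> colorable l G"
  unfolding colorable_def by (meson less_le_trans)

definition delete_vertex :: "'a ugraph \<Rightarrow> 'a \<Rightarrow> 'a ugraph" where
  "delete_vertex G v = (verts G - {v}, {e \<in> edges G. v \<notin> e})"

lemma delete_vertex_subgraph:
  "finite_simple_graph G \<Longrightarrow> subgraph (delete_vertex G v) G"
  unfolding subgraph_def finite_simple_graph_def delete_vertex_def by auto

lemma finite_edges:
  assumes "finite_simple_graph G"
  shows "finite (edges G)"
proof -
  have "edges G \<subseteq> Pow (verts G)" "finite (verts G)"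
    using assms unfolding finite_simple_graph_def by auto
  then show ?thesis
    by (meson finite_Pow_iff finite_subset)
qed

text \<open>Greedy extension: the neighbours of \<open>v\<close> block at most
  \<open>degree G v\<close> colours, fewer than \<open>k\<close>, so a free colour remains for
  \<open>v\<close>.\<close>

lemma colorable_add_vertex:
  assumes "finite_simple_graph G" "colorable k (delete_vertex G v)" "degree G v < k"
  shows "colorable k G"
proof -
  obtain c where c: "\<forall>u\<in>verts G - {v}. c u < k"
      "\<forall>u w. {u, w} \<in> edges G \<and> v \<notin> {u, w} \<longrightarrow> c u \<noteq> c w"
    using assms(2) unfolding colorable_def delete_vertex_def by auto
  define N where "N = {u. {u, v} \<in> edges G}"
  have N_edges: "(\<lambda>u. {u, v}) ` N \<subseteq> {e \<in> edges G. v \<in> e}"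
    unfolding N_def by auto
  have "inj_on (\<lambda>u. {u, v}) N"
    by (auto simp: inj_on_def doubleton_eq_iff)
  moreover have fin: "finite {e \<in> edges G. v \<in> e}"
    using finite_edges[OF assms(1)] by simp
  ultimately have "finite N" and "card N \<le> degree G v"
    unfolding degree_def using N_edges
    by (meson finite_imageD finite_subset, meson card_inj_on_le)
  then have "card (c ` N) < k"
    using assms(3) by (meson card_image_le le_less_trans)
  then have "\<not> {..<k} \<subseteq> c ` N"
    using \<open>finite N\<close> card_mono[of "c ` N" "{..<k}"] by auto
  then obtain a where a: "a < k" "a \<notin> c ` N"
    by auto
  have loop: "{v, v} \<notin> edges G"
    using assms(1) unfolding finite_simple_graph_def by auto
  have "(c(v := a)) u \<noteq> (c(v := a)) w" if "{u, w} \<in> edges G" for u w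
    using that c(2) a(2) loop unfolding N_def
    by (cases "u = v"; cases "w = v") (auto simp: insert_commute)
  then show ?thesis
    unfolding colorable_def using c(1) a(1) by (intro exI[of _ "c(v := a)"]) auto
qed

text \<open>Induction on the number of vertices: a vertex of degree at most \<open>d\<close> is
  deleted and then put back greedily.\<close>

lemma degenerate_colorable:
  assumes "finite_simple_graph G" "degenerate d G"
  shows "colorable (Suc d) G"
  using assms
proof (induction "card (verts G)" arbitrary: G rule: less_induct)
  case less
  have fin: "finite (verts G)" using less.prems(1) unfolding finite_simple_graph_def by simp
  show ?case
  proof (cases "verts G = {}")
    case True
    then have "edges G = {}"
      using less.prems(1) unfolding finite_simple_graph_def by fastforce
    with True show ?thesis unfolding colorable_def by simp
  next
    case False
    moreover have "subgraph G G"
      using less.prems(1) unfolding subgraph_def by simp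
    ultimately obtain v where v: "v \<in> verts G" "degree G v \<le> d"
      using less.prems(2) unfolding degenerate_def by blast
    have sub: "subgraph (delete_vertex G v) G"
      using less.prems(1) by (rule delete_vertex_subgraph)
    have "card (verts (delete_vertex G v)) < card (verts G)"
      unfolding delete_vertex_def using v(1) fin by (simp add: card_Diff1_less del: card_Diff_insert)
    moreover have "finite_simple_graph (delete_vertex G v)"
      using sub unfolding subgraph_def by simp
    ultimately have "colorable (Suc d) (delete_vertex G v)"
      using less.hyps degenerate_subgraph[OF less.prems(2) sub] by blast
    then show ?thesis
      using colorable_add_vertex[OF less.prems(1)] v(2) by auto
  qed
qed

text \<open>A proper colouring is injective on a clique. Applied to 3-colourable subgraphs, this
  excludes K_4.\<close>

lemma complete_colorable_card:
  assumes "colorable k H" "complete_graph H" "finite (verts H)"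
  shows "card (verts H) \<le> k"
proof -
  obtain c where c: "\<forall>v\<in>verts H. c v < k" "\<forall>u v. {u, v} \<in> edges H \<longrightarrow> c u \<noteq> c v"
    using assms(1) unfolding colorable_def by auto
  have "inj_on c (verts H)"
  proof (rule inj_onI, rule ccontr)
    fix u v assume "u \<in> verts H" "v \<in> verts H" "c u = c v" "u \<noteq> v"
    then have "{u, v} \<in> edges H"
      using assms(2) unfolding complete_graph_def by auto
    with c(2) \<open>c u = c v\<close> show False by blast
  qed
  moreover have "c ` verts H \<subseteq> {..<k}" using c(1) by auto
  ultimately have "card (verts H) \<le> card {..<k}" by (rule card_inj_on_le) simp
  then show ?thesis by simp
qed

lemma chromatic_number_eq_Suc:
  assumes "colorable (Suc k) G" "\<not> colorable k G"
  shows "chromatic_number G = Suc k"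
  unfolding chromatic_number_def
proof (rule Least_equality)
  show "Suc k \<le> l" if "colorable l G" for l
    using that assms(2) colorable_mono[of l G k] by (meson not_less_eq_eq)
qed (rule assms(1))


subsection \<open>Cycles through vertices of degree three\<close>

text \<open>The two neighbours sit at the cyclically adjacent positions of the list.\<close>

lemma cycle_graph_nbrs:
  assumes "cycle_graph C" "x \<in> verts C"
  obtains u w where "u \<noteq> w" "\<And>z. {x, z} \<in> edges C \<longleftrightarrow> z = u \<or> z = w"
proof -
  obtain xs where xs: "distinct xs" "length xs \<ge> 3" "C = (set xs, cyclic_edges xs)"
    using assms(1) unfolding cycle_graph_def by blast
  define n where "n = length xs"
  obtain i where i: "i < n" "x = xs ! i"
    using assms(2) xs(3) unfolding n_def by (auto simp: in_set_conv_nth)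
  \<comment> \<open>The cyclic predecessor of \<open>i\<close>; the case \<open>i = 0\<close> is
    separate because subtraction on naturals truncates.\<close>
  define j where "j = (if i = 0 then n - 1 else i - 1)"
  have j: "j < n" "Suc j mod n = i"
    using i(1) unfolding j_def by auto
  have j_unique: "l = j" if "l < n" "Suc l mod n = i" for l
    using that j i(1) unfolding j_def by (cases "Suc l = n") auto
  have nth: "xs ! l = xs ! l' \<longleftrightarrow> l = l'" if "l < n" "l' < n" for l l'
    using that xs(1) unfolding n_def by (simp add: nth_eq_iff_index_eq)
  have s: "Suc l mod n < n" for l using i(1) by auto
  \<comment> \<open>Here the length bound enters: on shorter lists predecessor and successor
    coincide.\<close>
  have "j \<noteq> Suc i mod n"
    using i(1) xs(2) unfolding j_def n_def by (cases "Suc i = length xs") auto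
  then have "xs ! j \<noteq> xs ! (Suc i mod n)"
    using nth j(1) s by blast
  moreover have "{x, z} \<in> edges C \<longleftrightarrow> z = xs ! j \<or> z = xs ! (Suc i mod n)" for z
  proof
    assume "{x, z} \<in> edges C"
    then obtain l where l: "l < n" "{x, z} = {xs ! l, xs ! (Suc l mod n)}"
      unfolding xs(3) cyclic_edges_def n_def by auto
    then consider "x = xs ! l" "z = xs ! (Suc l mod n)" | "x = xs ! (Suc l mod n)" "z = xs ! l"
      by (auto simp: doubleton_eq_iff)
    then show "z = xs ! j \<or> z = xs ! (Suc i mod n)"
    proof cases
      case 1
      then show ?thesis using nth i l(1) by metis
    next
      case 2
      then have "Suc l mod n = i" using nth i s by metis
      with 2 j_unique l(1) show ?thesis by blast
    qed
  next
    assume "z = xs ! j \<or> z = xs ! (Suc i mod n)"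
    then show "{x, z} \<in> edges C"
    proof
      assume "z = xs ! j"
      then have "{x, z} = {xs ! j, xs ! (Suc j mod n)}" using i(2) j(2) by auto
      with j(1) show ?thesis unfolding xs(3) cyclic_edges_def n_def by auto
    next
      assume "z = xs ! (Suc i mod n)"
      with i show ?thesis unfolding xs(3) cyclic_edges_def n_def by auto
    qed
  qed
  ultimately show thesis by (rule that)
qed

text \<open>Connectedness of a cycle: walking along it from \<open>x\<close> reaches every vertex
  and never leaves \<open>S\<close>.\<close>

lemma cycle_graph_closed:
  assumes "cycle_graph C" "x \<in> S" "x \<in> verts C"
    and closed: "\<And>y z. y \<in> S \<Longrightarrow> {y, z} \<in> edges C \<Longrightarrow> z \<in> S"
  shows "verts C \<subseteq> S"
proof
  fix y assume "y \<in> verts C"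
  obtain xs where xs: "C = (set xs, cyclic_edges xs)"
    using assms(1) unfolding cycle_graph_def by blast
  define n where "n = length xs"
  obtain i j where ij: "i < n" "x = xs ! i" "j < n" "y = xs ! j"
    using assms(3) \<open>y \<in> verts C\<close> xs unfolding n_def by (auto simp: in_set_conv_nth)
  have "xs ! ((i + d) mod n) \<in> S" for d
  proof (induction d)
    case 0
    then show ?case using assms(2) ij by simp
  next
    case (Suc d)
    have "(i + d) mod n < n" using ij(1) by auto
    then have "{xs ! ((i + d) mod n), xs ! (Suc ((i + d) mod n) mod n)} \<in> edges C"
      unfolding xs cyclic_edges_def n_def by auto
    then have "xs ! (Suc ((i + d) mod n) mod n) \<in> S"
      using Suc closed by blast
    then show ?case by (simp add: mod_Suc_eq)
  qed
  \<comment> \<open>\<open>i + (n - i + j) = n + j\<close>, which is \<open>j\<close> modulo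
    \<open>n\<close>.\<close>
  from this[of "n - i + j"] ij show "y \<in> S" by simp
qed

lemma edge_verts:
  assumes "finite_simple_graph G" "{x, z} \<in> edges G"
  shows "x \<in> verts G" "z \<in> verts G"
  using assms unfolding finite_simple_graph_def by auto

text \<open>The two cycle neighbours of \<open>x\<close> are among \<open>p\<close>,
  \<open>q\<close>, \<open>r\<close>. The outcome is spelled out in cases so that the conditions at
  several vertices can be combined propositionally.\<close>

lemma cycle_cubic_vertex:
  assumes "subgraph C G" "cycle_graph C" "x \<in> verts C"
    and "\<And>z. {x, z} \<in> edges G \<longleftrightarrow> z \<in> {p, q, r}" "p \<noteq> q" "p \<noteq> r" "q \<noteq> r"
  shows "({x, p} \<in> edges C \<and> {x, q} \<in> edges C \<and> {x, r} \<notin> edges C) \<or>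
         ({x, p} \<in> edges C \<and> {x, q} \<notin> edges C \<and> {x, r} \<in> edges C) \<or>
         ({x, p} \<notin> edges C \<and> {x, q} \<in> edges C \<and> {x, r} \<in> edges C)"
proof -
  obtain u w where uw: "u \<noteq> w" "\<And>z. {x, z} \<in> edges C \<longleftrightarrow> z = u \<or> z = w"
    using cycle_graph_nbrs[OF assms(2,3)] by metis
  then have "{x, u} \<in> edges G" "{x, w} \<in> edges G"
    using assms(1) unfolding subgraph_def by blast+
  then have "u \<in> {p, q, r}" "w \<in> {p, q, r}"
    using assms(4) by auto
  then show ?thesis
    using uw assms(5-7) by auto
qed

lemma chord_iff:
  "{x, z} \<in> chords G C \<longleftrightarrow> {x, z} \<in> edges G \<and> x \<in> verts C \<and> z \<in> verts C \<and> {x, z} \<notin> edges C"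
  unfolding chords_def by auto

text \<open>Two of the three edges at \<open>x\<close> lie on the cycle, which leaves a single
  candidate for a chord.\<close>

lemma cubic_chord_unique:
  assumes "subgraph C G" "cycle_graph C"
    and "\<And>z. {x, z} \<in> edges G \<longleftrightarrow> z \<in> {p, q, r}" "p \<noteq> q" "p \<noteq> r" "q \<noteq> r"
    and "{x, z} \<in> chords G C" "{x, z'} \<in> chords G C"
  shows "z = z'"
  using cycle_cubic_vertex[OF assms(1,2) _ assms(3-6)] assms(3,7,8)
  unfolding chord_iff by (smt (verit) empty_iff insert_iff)

text \<open>A triangle of vertices of degree three, with exits \<open>pp'\<close>, \<open>qq'\<close> and \<open>rr'\<close>: a cycle
  that meets the triangle is the triangle itself or uses exactly two exits.\<close>

context
  fixes C G :: "'a ugraph" and p q r p' q' r' :: 'a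
  assumes G: "finite_simple_graph G" and C: "subgraph C G" "cycle_graph C"
    and nbrs: "\<And>z. {p, z} \<in> edges G \<longleftrightarrow> z \<in> {q, r, p'}"
      "\<And>z. {q, z} \<in> edges G \<longleftrightarrow> z \<in> {p, r, q'}"
      "\<And>z. {r, z} \<in> edges G \<longleftrightarrow> z \<in> {p, q, r'}"
    and distinct: "distinct [p, q, r]" "p' \<notin> {p, q, r}" "q' \<notin> {p, q, r}" "r' \<notin> {p, q, r}"
begin

text \<open>The degree conditions at the three corners, with each side of the triangle written in
  one fixed orientation so that they share atoms.\<close>

lemma triangle_degrees:
  "p \<in> verts C \<Longrightarrow>
     ({p, q} \<in> edges C \<and> {p, r} \<in> edges C \<and> {p, p'} \<notin> edges C) \<or>
     ({p, q} \<in> edges C \<and> {p, r} \<notin> edges C \<and> {p, p'} \<in> edges C) \<or>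
     ({p, q} \<notin> edges C \<and> {p, r} \<in> edges C \<and> {p, p'} \<in> edges C)"
  "q \<in> verts C \<Longrightarrow>
     ({p, q} \<in> edges C \<and> {q, r} \<in> edges C \<and> {q, q'} \<notin> edges C) \<or>
     ({p, q} \<in> edges C \<and> {q, r} \<notin> edges C \<and> {q, q'} \<in> edges C) \<or>
     ({p, q} \<notin> edges C \<and> {q, r} \<in> edges C \<and> {q, q'} \<in> edges C)"
  "r \<in> verts C \<Longrightarrow>
     ({p, r} \<in> edges C \<and> {q, r} \<in> edges C \<and> {r, r'} \<notin> edges C) \<or>
     ({p, r} \<in> edges C \<and> {q, r} \<notin> edges C \<and> {r, r'} \<in> edges C) \<or>
     ({p, r} \<notin> edges C \<and> {q, r} \<in> edges C \<and> {r, r'} \<in> edges C)"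
  using cycle_cubic_vertex[OF C _ nbrs(1)] cycle_cubic_vertex[OF C _ nbrs(2)]
    cycle_cubic_vertex[OF C _ nbrs(3)] distinct
  by (auto simp: insert_commute)

lemma triangle_edge_verts:
  "{p, q} \<in> edges C \<Longrightarrow> p \<in> verts C \<and> q \<in> verts C"
  "{p, r} \<in> edges C \<Longrightarrow> p \<in> verts C \<and> r \<in> verts C"
  "{q, r} \<in> edges C \<Longrightarrow> q \<in> verts C \<and> r \<in> verts C"
  "{p, p'} \<in> edges C \<Longrightarrow> p \<in> verts C"
  using edge_verts C(1) unfolding subgraph_def by metis+

text \<open>A cycle entering through \<open>pp'\<close> continues along a side and, having degree
  two at every corner it visits, must leave at \<open>q\<close> or at \<open>r\<close>.\<close>

lemma triangle_leave:
  "{p, p'} \<in> edges C \<Longrightarrow> {q, q'} \<in> edges C \<or> {r, r'} \<in> edges C"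
  using triangle_degrees triangle_edge_verts by blast

text \<open>Without these two exits the cycle cannot use \<open>pp'\<close> either, so it is the
  triangle itself, which has no chords. In the applications \<open>p\<close> is the corner facing
  the rim, so the exits found lead towards the hub.\<close>

lemma triangle_chord_exits:
  assumes "e \<in> chords G C" "e \<inter> {p, q, r} \<noteq> {}"
  shows "{q, q'} \<in> edges C \<or> {r, r'} \<in> edges C"
proof (rule ccontr)
  assume no_exit: "\<not> ({q, q'} \<in> edges C \<or> {r, r'} \<in> edges C)"
  have "p \<in> verts C \<or> q \<in> verts C \<or> r \<in> verts C"
    using assms unfolding chords_def by auto
  then have all: "{p, q} \<in> edges C" "{p, r} \<in> edges C" "{q, r} \<in> edges C" "{p, p'} \<notin> edges C"
    using triangle_degrees triangle_edge_verts no_exit by blast+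
  have "z \<in> {p, q, r}" if "y \<in> {p, q, r}" "{y, z} \<in> edges C" for y z
  proof -
    have "{y, z} \<in> edges G" using that(2) C(1) unfolding subgraph_def by blast
    with that nbrs all no_exit show ?thesis by blast
  qed
  then have "verts C \<subseteq> {p, q, r}"
    using cycle_graph_closed[OF C(2), of p "{p, q, r}"] triangle_edge_verts(1)[OF all(1)] by blast
  then have sub: "e \<subseteq> {p, q, r}" using assms(1) unfolding chords_def by blast
  have "e \<in> edges G" using assms(1) unfolding chords_def by simp
  then have "card e = 2" using G unfolding finite_simple_graph_def by blast
  then obtain x z where "e = {x, z}" "x \<noteq> z" by (auto simp: card_2_iff)
  then have "e \<in> edges C" using all sub by (auto simp: insert_commute)
  with assms(1) show False unfolding chords_def by simp
qed

end


subsection \<open>The wheel with spokes replaced by trees of triangles\<close>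

text \<open>Vertex \<open>0\<close> is the hub. Slot \<open>0\<close> of each block lies on the rim, slots \<open>{1,2,3}\<close>,
  \<open>{4,5,6}\<close> and \<open>{7,8,9}\<close> form triangles, and the last two slots of the outer triangles
  \<open>{4,5,6}\<close> and \<open>{7,8,9}\<close> are joined to the hub.\<close>

definition vx :: "nat \<Rightarrow> nat \<Rightarrow> nat" where
  "vx i s = Suc (10 * i + s)"

definition slot_edges :: "(nat \<times> nat) set" where
  "slot_edges = {(0,1), (1,2), (1,3), (2,3), (2,4), (3,7),
                 (4,5), (4,6), (5,6), (7,8), (7,9), (8,9)}"

definition hub_slots :: "nat set" where
  "hub_slots = {5, 6, 8, 9}"

definition triangle_wheel :: "nat \<Rightarrow> nat ugraph" where
  "triangle_wheel k =
     ({..10 * k},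
      {{vx i 0, vx (Suc i mod k) 0} | i. i < k} \<union>
      {{vx i s, vx i t} | i s t. i < k \<and> (s, t) \<in> slot_edges} \<union>
      {{0, vx i s} | i s. i < k \<and> s \<in> hub_slots})"

section \<open>Numbering and adjacency in the triangle wheel\<close>

lemma vx_eq_iff [simp]: "s < 10 \<Longrightarrow> t < 10 \<Longrightarrow> vx i s = vx j t \<longleftrightarrow> i = j \<and> s = t"
  unfolding vx_def by presburger

lemma vx_neq_0 [simp]: "vx i s \<noteq> 0" "0 \<noteq> vx i s"
  unfolding vx_def by auto

lemma vx_cases:
  assumes "x \<in> verts (triangle_wheel k)" "x \<noteq> 0"
  obtains i s where "i < k" "s < 10" "x = vx i s"
proof
  show "(x - 1) div 10 < k" "(x - 1) mod 10 < 10" "x = vx ((x - 1) div 10) ((x - 1) mod 10)"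
    using assms unfolding vx_def triangle_wheel_def by auto
qed

lemma vx_in_verts: "i < k \<Longrightarrow> s < 10 \<Longrightarrow> vx i s \<in> verts (triangle_wheel k)"
  unfolding vx_def triangle_wheel_def by auto

lemma slot_cases:
  fixes s :: nat
  assumes "s < 10"
  obtains "s = 0" | "s = 1" | "s = 2" | "s = 3" | "s = 4" | "s = 5" | "s = 6" | "s = 7" | "s = 8" | "s = 9"
proof -
  have "s = 0 \<or> s = 1 \<or> s = 2 \<or> s = 3 \<or> s = 4 \<or> s = 5 \<or> s = 6 \<or> s = 7 \<or> s = 8 \<or> s = 9"
    using assms by presburger
  then show thesis using that by blast
qed

lemma card_triple: "card {a, b, c} \<le> 3"
  by (simp add: card_insert_if)

context
  fixes k :: nat
  assumes k: "3 \<le> k"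
begin

abbreviation "W \<equiv> triangle_wheel k"

definition rim_pred :: "nat \<Rightarrow> nat" where
  "rim_pred i = (if i = 0 then k - 1 else i - 1)"

text \<open>\<open>rim_pred\<close> inverts the cyclic successor on block indices;
  \<open>3 \<le> k\<close> keeps a block and its two rim neighbours distinct.\<close>

lemma rim_pred:
  assumes "i < k"
  shows "rim_pred i < k" "Suc i mod k < k" "rim_pred i \<noteq> i" "Suc i mod k \<noteq> i" "Suc i mod k \<noteq> rim_pred i"
    "j < k \<Longrightarrow> i = Suc j mod k \<longleftrightarrow> j = rim_pred i"
  using assms k unfolding rim_pred_def
  by (cases "Suc i = k"; cases "Suc j = k"; auto)+

text \<open>Turns the three families of edges into a local description at one vertex, using that the
  numbering \<open>vx\<close> is injective on slots below 10.\<close>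

lemma edges_vx:
  assumes "i < k" "s < 10"
  shows "{vx i s, z} \<in> edges W \<longleftrightarrow>
    (s = 0 \<and> (z = vx (Suc i mod k) 0 \<or> z = vx (rim_pred i) 0)) \<or>
    (\<exists>t. ((s, t) \<in> slot_edges \<or> (t, s) \<in> slot_edges) \<and> z = vx i t) \<or>
    (s \<in> hub_slots \<and> z = 0)" (is "?L \<longleftrightarrow> ?R")
proof
  have slots: "s < 10 \<and> t < 10" if "(s, t) \<in> slot_edges" for s t
    using that unfolding slot_edges_def by auto
  have hub: "s < 10" if "s \<in> hub_slots" for s
    using that unfolding hub_slots_def by auto
  show ?R if ?L
  proof -
    from that consider j where "j < k" "{vx i s, z} = {vx j 0, vx (Suc j mod k) 0}"
      | j a b where "j < k" "(a, b) \<in> slot_edges" "{vx i s, z} = {vx j a, vx j b}"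
      | j a where "j < k" "a \<in> hub_slots" "{vx i s, z} = {0, vx j a}"
      unfolding triangle_wheel_def by auto
    then show ?R
    proof cases
      case 1
      then show ?thesis using assms rim_pred(6)[OF assms(1)] by (auto simp: doubleton_eq_iff)
    next
      case 2
      then show ?thesis using assms slots by (auto simp: doubleton_eq_iff)
    next
      case 3
      then show ?thesis using assms hub by (auto simp: doubleton_eq_iff)
    qed
  qed
  show ?L if ?R
  proof -
    from that consider "s = 0" "z = vx (Suc i mod k) 0" | "s = 0" "z = vx (rim_pred i) 0"
      | t where "(s, t) \<in> slot_edges" "z = vx i t" | t where "(t, s) \<in> slot_edges" "z = vx i t"
      | "s \<in> hub_slots" "z = 0" by blast
    then show ?L
    proof cases
      case 2
      have "vx i s = vx (Suc (rim_pred i) mod k) 0"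
        using rim_pred[OF assms(1)] 2(1) by auto
      with 2 rim_pred(1)[OF assms(1)] show ?thesis
        unfolding triangle_wheel_def by (auto simp: insert_commute)
    next
      case 4
      with assms show ?thesis unfolding triangle_wheel_def by (auto simp: insert_commute)
    next
      case 5
      with assms show ?thesis unfolding triangle_wheel_def by (auto simp: insert_commute)
    qed (use assms in \<open>auto simp: triangle_wheel_def\<close>)
  qed
qed

text \<open>At a corner of a triangle the other two corners come first and the exit last. Facts 2-4,
  5-7 and 8-10 thus match the assumptions of the triangle lemmas.\<close>

lemma nbrs:
  assumes "i < k"
  shows "{vx i 0, z} \<in> edges W \<longleftrightarrow> z \<in> {vx (Suc i mod k) 0, vx (rim_pred i) 0, vx i 1}"
    "{vx i 1, z} \<in> edges W \<longleftrightarrow> z \<in> {vx i 2, vx i 3, vx i 0}"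
    "{vx i 2, z} \<in> edges W \<longleftrightarrow> z \<in> {vx i 1, vx i 3, vx i 4}"
    "{vx i 3, z} \<in> edges W \<longleftrightarrow> z \<in> {vx i 1, vx i 2, vx i 7}"
    "{vx i 4, z} \<in> edges W \<longleftrightarrow> z \<in> {vx i 5, vx i 6, vx i 2}"
    "{vx i 5, z} \<in> edges W \<longleftrightarrow> z \<in> {vx i 4, vx i 6, 0}"
    "{vx i 6, z} \<in> edges W \<longleftrightarrow> z \<in> {vx i 4, vx i 5, 0}"
    "{vx i 7, z} \<in> edges W \<longleftrightarrow> z \<in> {vx i 8, vx i 9, vx i 3}"
    "{vx i 8, z} \<in> edges W \<longleftrightarrow> z \<in> {vx i 7, vx i 9, 0}"
    "{vx i 9, z} \<in> edges W \<longleftrightarrow> z \<in> {vx i 7, vx i 8, 0}"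
  by (auto simp: edges_vx[OF assms] slot_edges_def hub_slots_def)

lemma W_simple: "finite_simple_graph W"
proof -
  have "e \<subseteq> verts W \<and> card e = 2" if "e \<in> edges W" for e
  proof -
    from that consider i where "i < k" "e = {vx i 0, vx (Suc i mod k) 0}"
      | i a b where "i < k" "(a, b) \<in> slot_edges" "e = {vx i a, vx i b}"
      | i a where "i < k" "a \<in> hub_slots" "e = {0, vx i a}"
      unfolding triangle_wheel_def by auto
    then show ?thesis
    proof cases
      case 1
      then show ?thesis using rim_pred[OF 1(1)] vx_in_verts by auto
    next
      case 2
      then show ?thesis using vx_in_verts unfolding slot_edges_def by auto
    next
      case 3
      moreover have "0 \<in> verts W" unfolding triangle_wheel_def by simp
      ultimately show ?thesis using vx_in_verts unfolding hub_slots_def by auto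
    qed
  qed
  moreover have "finite (verts W)" unfolding triangle_wheel_def by simp
  ultimately show ?thesis unfolding finite_simple_graph_def by blast
qed

lemma cubic:
  assumes "i < k" "s < 10"
  obtains p q r where "p \<noteq> q" "p \<noteq> r" "q \<noteq> r" "\<And>z. {vx i s, z} \<in> edges W \<longleftrightarrow> z \<in> {p, q, r}"
proof -
  note intro = that
  have *: thesis if "s = t" "p \<noteq> q" "p \<noteq> r" "q \<noteq> r"
    "\<And>z. {vx i t, z} \<in> edges W \<longleftrightarrow> z \<in> {p, q, r}" for t p q r
    using that(2-5) unfolding that(1)[symmetric] by (rule intro)
  note n = nbrs[OF assms(1)]
  from assms(2) show thesis
  proof (cases rule: slot_cases)
    case 1
    show thesis by (rule *[OF 1 _ _ _ n(1)]) (use rim_pred[OF assms(1)] in simp_all)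
  next
    case 2
    show thesis by (rule *[OF 2 _ _ _ n(2)]) simp_all
  next
    case 3
    show thesis by (rule *[OF 3 _ _ _ n(3)]) simp_all
  next
    case 4
    show thesis by (rule *[OF 4 _ _ _ n(4)]) simp_all
  next
    case 5
    show thesis by (rule *[OF 5 _ _ _ n(5)]) simp_all
  next
    case 6
    show thesis by (rule *[OF 6 _ _ _ n(6)]) simp_all
  next
    case 7
    show thesis by (rule *[OF 7 _ _ _ n(7)]) simp_all
  next
    case 8
    show thesis by (rule *[OF 8 _ _ _ n(8)]) simp_all
  next
    case 9
    show thesis by (rule *[OF 9 _ _ _ n(9)]) simp_all
  next
    case 10
    show thesis by (rule *[OF 10 _ _ _ n(10)]) simp_all
  qed
qed

text \<open>Passes from neighbours to incident edges, which is what \<open>degree\<close>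
  counts.\<close>

lemma cubic_edges:
  assumes "i < k" "s < 10"
  obtains p q r where "{e \<in> edges W. vx i s \<in> e} = {{vx i s, p}, {vx i s, q}, {vx i s, r}}"
proof -
  obtain p q r where pqr: "\<And>z. {vx i s, z} \<in> edges W \<longleftrightarrow> z \<in> {p, q, r}"
    using cubic[OF assms] by metis
  have "{e \<in> edges W. vx i s \<in> e} = {{vx i s, p}, {vx i s, q}, {vx i s, r}}" (is "?L = ?R")
  proof
    show "?L \<subseteq> ?R"
    proof
      fix e assume e: "e \<in> ?L"
      then have "card e = 2" using W_simple unfolding finite_simple_graph_def by auto
      with e obtain z where z: "e = {vx i s, z}" by (auto simp: card_2_iff)
      with e have "z \<in> {p, q, r}" using pqr by blast
      with z show "e \<in> ?R" by blast
    qed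
    show "?R \<subseteq> ?L" using pqr by auto
  qed
  then show thesis by (rule that)
qed

section \<open>Criticality, K_4-freeness and the chromatic number\<close>

lemma edge_has_vx:
  assumes "e \<in> edges W"
  obtains i s z where "i < k" "s < 10" "e = {vx i s, z}"
proof -
  have "card e = 2" "e \<subseteq> verts W" using assms W_simple unfolding finite_simple_graph_def by auto
  then obtain x z where e: "e = {x, z}" "x \<noteq> z" "x \<in> verts W" "z \<in> verts W"
    by (auto simp: card_2_iff)
  show thesis
  proof (cases "x = 0")
    case True
    with e that show thesis by (metis insert_commute vx_cases)
  next
    case False
    with e that show thesis by (metis vx_cases)
  qed
qed

text \<open>A nonempty subgraph of minimum degree at least three contains, with every vertex other than
  the hub, all edges at this vertex. As removing the hub leaves a connected graph, it is everything.\<close>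

lemma min_degree_subgraph:
  assumes H: "subgraph H W" "verts H \<noteq> {}" and deg: "\<And>v. v \<in> verts H \<Longrightarrow> degree H v > 2"
  shows "H = W"
proof -
  have simple: "finite_simple_graph H" using H(1) unfolding subgraph_def by simp
  \<comment> \<open>Only three edges of \<open>W\<close> are available at a non-hub vertex, so
    degree at least three in \<open>H\<close> forces all of them.\<close>
  have full: "{vx i s, z} \<in> edges H"
    if b: "i < k" "s < 10" and v: "vx i s \<in> verts H" and z: "{vx i s, z} \<in> edges W" for i s z
  proof -
    obtain p q r where pqr: "{e \<in> edges W. vx i s \<in> e} = {{vx i s, p}, {vx i s, q}, {vx i s, r}}"
      using cubic_edges[OF b] by metis
    let ?E = "{{vx i s, p}, {vx i s, q}, {vx i s, r}}"
    have sub: "{e \<in> edges H. vx i s \<in> e} \<subseteq> ?E"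
      using H(1) unfolding pqr[symmetric] subgraph_def by blast
    have "card ?E \<le> 3" by (rule card_triple)
    with deg[OF v] have "card ?E \<le> card {e \<in> edges H. vx i s \<in> e}"
      unfolding degree_def by linarith
    then have "{e \<in> edges H. vx i s \<in> e} = {e \<in> edges W. vx i s \<in> e}"
      unfolding pqr using sub by (intro card_seteq) auto
    moreover have "{vx i s, z} \<in> {e \<in> edges W. vx i s \<in> e}" using z by simp
    ultimately show ?thesis by blast
  qed
  then have step: "z \<in> verts H" if "i < k" "s < 10" "vx i s \<in> verts H" "{vx i s, z} \<in> edges W" for i s z
    using that edge_verts[OF simple] by blast
  \<comment> \<open>The hub alone would be an isolated vertex, against the degree bound.\<close>
  have "\<exists>v\<in>verts H. v \<noteq> 0"
  proof (rule ccontr)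
    assume "\<not> ?thesis"
    then have only: "verts H = {0}" using H(2) by auto
    have "e \<notin> edges H" for e
    proof
      assume "e \<in> edges H"
      then have "e \<subseteq> {0}" "card e = 2"
        using simple only unfolding finite_simple_graph_def by auto
      then show False using card_mono[of "{0}" e] by simp
    qed
    then show False using deg[of 0] only unfolding degree_def by simp
  qed
  then obtain i0 s0 where is0: "i0 < k" "s0 < 10" "vx i0 s0 \<in> verts H"
    using H(1) unfolding subgraph_def by (metis subsetD vx_cases)
  \<comment> \<open>Inside a block every vertex has a path to the rim: through slot 4 or 7, then 2
    or 3, then 1.\<close>
  have to_rim: "vx i 0 \<in> verts H" if i: "i < k" and s: "s < 10" "vx i s \<in> verts H" for i s
  proof -
    have a: "vx i 1 \<in> verts H \<Longrightarrow> vx i 0 \<in> verts H"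
      using step[OF i, of 1 "vx i 0"] nbrs[OF i] by simp
    have b: "vx i 2 \<in> verts H \<Longrightarrow> vx i 1 \<in> verts H" "vx i 3 \<in> verts H \<Longrightarrow> vx i 1 \<in> verts H"
      using step[OF i, of 2 "vx i 1"] step[OF i, of 3 "vx i 1"] nbrs[OF i] by simp_all
    have c: "vx i 4 \<in> verts H \<Longrightarrow> vx i 2 \<in> verts H" "vx i 7 \<in> verts H \<Longrightarrow> vx i 3 \<in> verts H"
      using step[OF i, of 4 "vx i 2"] step[OF i, of 7 "vx i 3"] nbrs[OF i] by simp_all
    have d: "vx i 5 \<in> verts H \<Longrightarrow> vx i 4 \<in> verts H" "vx i 6 \<in> verts H \<Longrightarrow> vx i 4 \<in> verts H"
       "vx i 8 \<in> verts H \<Longrightarrow> vx i 7 \<in> verts H" "vx i 9 \<in> verts H \<Longrightarrow> vx i 7 \<in> verts H"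
      using step[OF i, of 5 "vx i 4"] step[OF i, of 6 "vx i 4"]
        step[OF i, of 8 "vx i 7"] step[OF i, of 9 "vx i 7"] nbrs[OF i] by simp_all
    from s(1) show ?thesis
      by (cases rule: slot_cases) (use s(2) a b c d in simp_all)
  qed
  \<comment> \<open>Going round the rim collects the rim vertices of all blocks.\<close>
  have walk: "vx ((i0 + d) mod k) 0 \<in> verts H" for d
  proof (induction d)
    case 0
    then show ?case using to_rim is0 by simp
  next
    case (Suc d)
    have "(i0 + d) mod k < k" using k by simp
    from step[OF this _ Suc, of "vx (Suc ((i0 + d) mod k) mod k) 0"] nbrs(1)[OF this]
    show ?case by (simp add: mod_Suc_eq)
  qed
  have rim: "vx i 0 \<in> verts H" if "i < k" for i
    using walk[of "k - i0 + i"] that is0(1) by simp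
  \<comment> \<open>The same paths are now followed from the rim towards the hub.\<close>
  have all: "vx i s \<in> verts H" if i: "i < k" and s: "s < 10" for i s
  proof -
    have a: "vx i 1 \<in> verts H"
      using step[OF i _ rim[OF i], of "vx i 1"] nbrs[OF i] by simp
    have b: "vx i 2 \<in> verts H" "vx i 3 \<in> verts H"
      using step[OF i _ a] nbrs[OF i] by simp_all
    have c: "vx i 4 \<in> verts H" "vx i 7 \<in> verts H"
      using step[OF i _ b(1)] step[OF i _ b(2)] nbrs[OF i] by simp_all
    have d: "vx i 5 \<in> verts H" "vx i 6 \<in> verts H" "vx i 8 \<in> verts H" "vx i 9 \<in> verts H"
      using step[OF i _ c(1)] step[OF i _ c(2)] nbrs[OF i] by simp_all
    from s show ?thesis
      by (cases rule: slot_cases) (use rim[OF i] a b c d in simp_all)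
  qed
  have "edges W \<subseteq> edges H"
  proof
    fix e assume "e \<in> edges W"
    then show "e \<in> edges H" using full all by (metis edge_has_vx)
  qed
  then have edges: "edges H = edges W" using H(1) unfolding subgraph_def by blast
  have "{vx 0 5, 0} \<in> edges W" using nbrs k by simp
  then have "0 \<in> verts H" using step[of 0 5 0] all k by simp
  then have "verts W \<subseteq> verts H" using all by (metis subsetI vx_cases)
  then show ?thesis
    using edges H(1) unfolding subgraph_def by (simp add: prod_eq_iff subset_antisym)
qed

text \<open>A subgraph of a proper subgraph is never \<open>W\<close>, so minimum degree at least
  three is impossible in it.\<close>

lemma proper_degenerate:
  assumes "proper_subgraph H W"
  shows "degenerate 2 H"
  unfolding degenerate_def
proof (intro allI impI)
  fix K assume K: "subgraph K H \<and> verts K \<noteq> {}"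
  then have KW: "subgraph K W"
    using assms subgraph_trans unfolding proper_subgraph_def by blast
  have "K \<noteq> W"
    using K assms unfolding proper_subgraph_def subgraph_def by (auto simp: prod_eq_iff)
  then show "\<exists>v\<in>verts K. degree K v \<le> 2"
    using min_degree_subgraph[OF KW] K by (meson not_le)
qed

lemma proper_colorable:
  assumes "proper_subgraph H W"
  shows "colorable 3 H"
proof -
  have "finite_simple_graph H"
    using assms unfolding proper_subgraph_def subgraph_def by blast
  from degenerate_colorable[OF this proper_degenerate[OF assms]] show ?thesis
    by (simp add: eval_nat_numeral)
qed

text \<open>A K_4 has fewer vertices than \<open>W\<close>, hence would be a proper subgraph and
  3-colourable.\<close>

lemma W_K4_free: "K_free 4 W"
  unfolding K_free_def
proof
  assume "\<exists>H. subgraph H W \<and> complete_graph H \<and> card (verts H) = 4"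
  then obtain H where H: "subgraph H W" "complete_graph H" "card (verts H) = 4" by blast
  have "card (verts W) = 10 * k + 1" unfolding triangle_wheel_def by simp
  then have "H \<noteq> W" using H(3) k by auto
  then have "colorable 3 H" using H(1) proper_colorable unfolding proper_subgraph_def by blast
  moreover have "finite (verts H)" using H(3) by (simp add: card_ge_0_finite)
  ultimately show False using complete_colorable_card[OF _ H(2)] H(3) by fastforce
qed

text \<open>In a 3-colouring, the triangles force the attachment vertex of each to share the colour
  of the hub, so the odd rim would be 2-coloured.\<close>

lemma W_not_3_colorable:
  assumes "odd k"
  shows "\<not> colorable 3 W"
proof
  assume "colorable 3 W"
  then obtain c where bound: "\<And>v. v \<in> verts W \<Longrightarrow> c v < (3::nat)"
    and proper: "\<And>u v. {u, v} \<in> edges W \<Longrightarrow> c u \<noteq> c v"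
    unfolding colorable_def by blast
  \<comment> \<open>The colours of \<open>q\<close> and \<open>r\<close> are distinct and avoided by
    both \<open>c p\<close> and \<open>d\<close>, so these two are the one remaining colour.\<close>
  have force: "c p = d" if "c p < 3" "c q < 3" "c r < 3" "d < 3"
    "c p \<noteq> c q" "c p \<noteq> c r" "c q \<noteq> c r" "c q \<noteq> d" "c r \<noteq> d" for p q r d
    using that by linarith
  \<comment> \<open>\<open>x\<close>, \<open>y\<close>, \<open>z\<close> avoid the colour
    \<open>d\<close>, so they range over only two colours.\<close>
  have two: "y = z \<longleftrightarrow> x \<noteq> z" if "x < 3" "y < 3" "z < 3" "d < 3" "x \<noteq> y" "x \<noteq> d" "y \<noteq> d" "z \<noteq> d"
    for x y z d :: nat
    using that by presburger
  have hub: "c 0 < 3" using bound unfolding triangle_wheel_def by simp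
  have b: "c (vx i s) < 3" if "i < k" "s < 10" for i s
    using bound vx_in_verts that by blast
  \<comment> \<open>The hub colour propagates through the outer triangles to slots 4 and 7, and
    through the inner triangle to slot 1, next to the rim.\<close>
  have rim: "c (vx i 0) \<noteq> c 0" if i: "i < k" for i
  proof -
    note n = nbrs[OF i]
    have "c (vx i 4) = c 0"
      by (rule force[of _ "vx i 5" "vx i 6"]; (rule proper)?; simp add: n b i hub)
    moreover have "c (vx i 7) = c 0"
      by (rule force[of _ "vx i 8" "vx i 9"]; (rule proper)?; simp add: n b i hub)
    moreover have "c (vx i 2) \<noteq> c (vx i 4)" "c (vx i 3) \<noteq> c (vx i 7)"
      by (rule proper; simp add: n)+
    moreover have "c (vx i 1) \<noteq> c (vx i 2)" "c (vx i 1) \<noteq> c (vx i 3)" "c (vx i 2) \<noteq> c (vx i 3)"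
      by (rule proper; simp add: n del: One_nat_def)+
    ultimately have "c (vx i 1) = c 0"
      using force[of "vx i 1" "vx i 2" "vx i 3" "c 0"] b[OF i] hub by simp
    moreover have "c (vx i 0) \<noteq> c (vx i 1)"
      by (rule proper; simp add: n del: One_nat_def)
    ultimately show ?thesis by simp
  qed
  have step: "c (vx i 0) \<noteq> c (vx (Suc i mod k) 0)" if "i < k" for i
    by (rule proper) (simp add: nbrs that)
  have alternate: "c (vx i 0) = c (vx 0 0) \<longleftrightarrow> even i" if "i < k" for i
    using that
  proof (induction i)
    case (Suc i)
    have "c (vx i 0) \<noteq> c (vx (Suc i) 0)" using step[of i] Suc.prems by simp
    moreover have "c (vx i 0) = c (vx 0 0) \<longleftrightarrow> even i" using Suc by simp
    moreover have "c (vx i 0) < 3" "c (vx (Suc i) 0) < 3" "c (vx 0 0) < 3"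
      using b Suc.prems by simp_all
    moreover have "c (vx i 0) \<noteq> c 0" "c (vx (Suc i) 0) \<noteq> c 0" "c (vx 0 0) \<noteq> c 0"
      using rim Suc.prems by simp_all
    ultimately have "c (vx (Suc i) 0) = c (vx 0 0) \<longleftrightarrow> c (vx i 0) \<noteq> c (vx 0 0)"
      using hub two by blast
    with Suc show ?case by simp
  qed simp
  \<comment> \<open>The edge closing the rim; as \<open>k - 1\<close> is even, alternation gives its
    two ends the same colour.\<close>
  have "c (vx (k - 1) 0) \<noteq> c (vx 0 0)" using step[of "k - 1"] k by simp
  with alternate[of "k - 1"] assms k show False by simp
qed

text \<open>Deleting a rim vertex leaves a 3-colourable graph; the vertex has at most three
  neighbours, so four colours suffice to put it back.\<close>

lemma W_chromatic_number:
  assumes "odd k"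
  shows "chromatic_number W = 4"
proof -
  let ?D = "delete_vertex W (vx 0 0)"
  have "vx 0 0 \<in> verts W" using vx_in_verts k by simp
  then have "verts ?D \<noteq> verts W" unfolding delete_vertex_def by auto
  then have "?D \<noteq> W" by metis
  then have "colorable 3 ?D"
    using proper_colorable delete_vertex_subgraph[OF W_simple] unfolding proper_subgraph_def by blast
  then have "colorable 4 ?D" using colorable_mono[of 3 ?D 4] by simp
  moreover have "degree W (vx 0 0) < 4"
  proof -
    obtain p q r where "{e \<in> edges W. vx 0 0 \<in> e} = {{vx 0 0, p}, {vx 0 0, q}, {vx 0 0, r}}"
      using cubic_edges[of 0 0] k by auto
    then show ?thesis
      unfolding degree_def using card_triple[of "{vx 0 0, p}" "{vx 0 0, q}" "{vx 0 0, r}"] by simp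
  qed
  ultimately have "colorable 4 W" by (rule colorable_add_vertex[OF W_simple])
  then show ?thesis
    using chromatic_number_eq_Suc[of 3 W] W_not_3_colorable[OF assms] by simp
qed

section \<open>Chords of a fixed cycle\<close>

context
  fixes C :: "nat ugraph"
  assumes C: "subgraph C W" "cycle_graph C"
begin

text \<open>The hub edges of the cycle, encoded by block and slot of the other end, so that each
  remembers its outer triangle.\<close>

definition hub_used :: "(nat \<times> nat) set" where
  "hub_used = {(i, s). i < k \<and> s \<in> hub_slots \<and> {vx i s, 0} \<in> edges C}"

lemma hub_used_card: "finite hub_used" "card hub_used \<le> 2"
proof -
  have sub: "(\<lambda>(i, s). vx i s) ` hub_used \<subseteq> {z. {0, z} \<in> edges C}"
    unfolding hub_used_def by (auto simp: insert_commute)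
  have inj: "inj_on (\<lambda>(i, s). vx i s) hub_used"
    unfolding hub_used_def hub_slots_def inj_on_def by auto
  obtain u w where "{z. {0, z} \<in> edges C} \<subseteq> {u, w}"
  proof (cases "0 \<in> verts C")
    case True
    then obtain u w where "\<And>z. {0, z} \<in> edges C \<longleftrightarrow> z = u \<or> z = w"
      using cycle_graph_nbrs[OF C(2)] by metis
    then show thesis by (intro that[of u w]) auto
  next
    case False
    have "{0, z} \<notin> edges C" for z
      using False edge_verts(1)[of C 0 z] C(1) unfolding subgraph_def by blast
    then show thesis by (intro that) simp
  qed
  then have uw: "(\<lambda>(i, s). vx i s) ` hub_used \<subseteq> {u, w}" using sub by blast
  show "finite hub_used"
    using inj uw by (meson finite.intros finite_imageD finite_subset)
  have "card hub_used \<le> card {u, w}"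
    using inj uw by (intro card_inj_on_le) auto
  also have "\<dots> \<le> 2" by (simp add: card_insert_if)
  finally show "card hub_used \<le> 2" .
qed

text \<open>Here \<open>t\<close> is 4 or 7, the corner of an outer triangle facing the rim; the
  other two corners are its hub slots.\<close>

definition active :: "nat \<Rightarrow> nat \<Rightarrow> bool" where
  "active i t \<longleftrightarrow> (i, t + 1) \<in> hub_used \<or> (i, t + 2) \<in> hub_used"

lemma active_iff:
  assumes "i < k"
  shows "active i 4 \<longleftrightarrow> {vx i 5, 0} \<in> edges C \<or> {vx i 6, 0} \<in> edges C"
    "active i 7 \<longleftrightarrow> {vx i 8, 0} \<in> edges C \<or> {vx i 9, 0} \<in> edges C"
  using assms unfolding active_def hub_used_def hub_slots_def by auto

text \<open>The exits of an outer triangle other than the one towards the rim are hub edges, so the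
  triangle lemmas yield a used hub edge directly.\<close>

lemma outer_active:
  assumes i: "i < k"
  shows "{vx i 4, vx i 2} \<in> edges C \<Longrightarrow> active i 4"
    "{vx i 7, vx i 3} \<in> edges C \<Longrightarrow> active i 7"
    "e \<in> chords W C \<Longrightarrow> e \<inter> {vx i 4, vx i 5, vx i 6} \<noteq> {} \<Longrightarrow> active i 4"
    "e \<in> chords W C \<Longrightarrow> e \<inter> {vx i 7, vx i 8, vx i 9} \<noteq> {} \<Longrightarrow> active i 7"
  unfolding active_iff[OF i]
  using triangle_leave[OF W_simple C nbrs(5-7)[OF i]] triangle_leave[OF W_simple C nbrs(8-10)[OF i]]
    triangle_chord_exits[OF W_simple C nbrs(5-7)[OF i], of e]
    triangle_chord_exits[OF W_simple C nbrs(8-10)[OF i], of e]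
  by simp_all

text \<open>One level further from the hub: the exits found at the inner triangle enter an outer
  triangle, where \<open>outer_active\<close> takes over.\<close>

lemma inner_active:
  assumes i: "i < k"
  shows "{vx i 1, vx i 0} \<in> edges C \<Longrightarrow> active i 4 \<or> active i 7"
    "e \<in> chords W C \<Longrightarrow> e \<inter> {vx i 1, vx i 2, vx i 3} \<noteq> {} \<Longrightarrow> active i 4 \<or> active i 7"
proof -
  have link: "active i 4 \<or> active i 7"
    if "{vx i 2, vx i 4} \<in> edges C \<or> {vx i 3, vx i 7} \<in> edges C"
    using that outer_active(1,2)[OF i] by (auto simp: insert_commute)
  show "active i 4 \<or> active i 7" if "{vx i 1, vx i 0} \<in> edges C"
    by (rule link, rule triangle_leave[OF W_simple C nbrs(2-4)[OF i] _ _ _ _ that]) simp_all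
  show "active i 4 \<or> active i 7"
    if "e \<in> chords W C" "e \<inter> {vx i 1, vx i 2, vx i 3} \<noteq> {}"
    by (rule link, rule triangle_chord_exits[OF W_simple C nbrs(2-4)[OF i] _ _ _ _ that]) simp_all
qed

text \<open>In an inactive block the cycle passes slot 0 along the rim, so a chord there must go to
  slot 1 and meets the inner triangle.\<close>

lemma rim_active:
  assumes i: "i < k" and e: "e \<in> chords W C" "vx i 0 \<in> e"
  shows "active i 4 \<or> active i 7"
proof (rule ccontr)
  assume not_active: "\<not> ?thesis"
  then have "{vx i 0, vx i 1} \<notin> edges C"
    using inner_active(1)[OF i] by (auto simp: insert_commute)
  moreover have "vx i 0 \<in> verts C" using e unfolding chords_def by auto
  ultimately have rim: "{vx i 0, vx (Suc i mod k) 0} \<in> edges C" "{vx i 0, vx (rim_pred i) 0} \<in> edges C"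
    using cycle_cubic_vertex[OF C _ nbrs(1)[OF i]] rim_pred[OF i] by auto
  have "e \<in> edges W" using e(1) unfolding chords_def by simp
  then have "card e = 2" using W_simple unfolding finite_simple_graph_def by blast
  then obtain z where z: "e = {vx i 0, z}" using e(2) by (auto simp: card_2_iff)
  with \<open>e \<in> edges W\<close> have "z \<in> {vx (Suc i mod k) 0, vx (rim_pred i) 0, vx i 1}"
    using nbrs(1)[OF i] by blast
  then have "z = vx i 1" using z rim e(1) unfolding chords_def by auto
  then have "e \<inter> {vx i 1, vx i 2, vx i 3} \<noteq> {}" using z by auto
  with inner_active(2)[OF i e(1)] not_active show False by blast
qed

text \<open>The seven vertices between the rim and a hub edge: the rim vertex, the inner triangle
  and the outer triangle containing slot \<open>s\<close>. The test \<open>s < 7\<close> separates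
  hub slots 5, 6 from 8, 9.\<close>

definition near :: "nat \<times> nat \<Rightarrow> nat set" where
  "near = (\<lambda>(i, s). vx i ` ({0, 1, 2, 3} \<union> (if s < 7 then {4, 5, 6} else {7, 8, 9})))"

lemma card_near: "card (near u) \<le> 7" "finite (near u)"
proof -
  obtain i s where u: "u = (i, s)" by (cases u)
  let ?S = "{0, 1, 2, 3} \<union> (if s < 7 then {4, 5, 6} else {7, 8, 9}) :: nat set"
  have "card (vx i ` ?S) \<le> card ?S" by (rule card_image_le) simp
  also have "\<dots> = 7" by simp
  finally show "card (near u) \<le> 7" unfolding near_def u by simp
  show "finite (near u)" unfolding near_def u by simp
qed

lemma active_near:
  assumes "active i t" "t = 4 \<or> t = 7" "s \<in> {0, 1, 2, 3, t, t + 1, t + 2}"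
  shows "vx i s \<in> \<Union> (near ` hub_used)"
proof -
  obtain r where r: "(i, r) \<in> hub_used" "r = t + 1 \<or> r = t + 2"
    using assms(1) unfolding active_def by blast
  have "vx i s \<in> near (i, r)"
    using r(2) assms(2,3) unfolding near_def by auto
  with r(1) show ?thesis by blast
qed

lemma chord_near:
  assumes i: "i < k" "s < 10" and e: "e \<in> chords W C" "vx i s \<in> e"
  shows "vx i s \<in> \<Union> (near ` hub_used)"
proof -
  consider "s = 0" | "s \<in> {1, 2, 3}" | "s \<in> {4, 5, 6}" | "s \<in> {7, 8, 9}"
    using i(2) by (cases rule: slot_cases) auto
  then show ?thesis
  proof cases
    case 1
    then show ?thesis using rim_active[OF i(1) e(1)] e(2) active_near[of i _ s] by auto
  next
    case 2
    then have "e \<inter> {vx i 1, vx i 2, vx i 3} \<noteq> {}" using e(2) by auto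
    with 2 show ?thesis using inner_active(2)[OF i(1) e(1)] active_near[of i _ s] by auto
  next
    case 3
    then have "e \<inter> {vx i 4, vx i 5, vx i 6} \<noteq> {}" using e(2) by auto
    with 3 show ?thesis using outer_active(3)[OF i(1) e(1)] active_near[of i 4 s] by auto
  next
    case 4
    then have "e \<inter> {vx i 7, vx i 8, vx i 9} \<noteq> {}" using e(2) by auto
    with 4 show ?thesis using outer_active(4)[OF i(1) e(1)] active_near[of i 7 s] by auto
  qed
qed

lemma chord_card: "e \<in> chords W C \<Longrightarrow> e \<in> edges W \<and> e \<subseteq> verts W \<and> card e = 2"
  using W_simple unfolding chords_def finite_simple_graph_def by auto

lemma chords_finite: "finite (chords W C)"
  using finite_edges[OF W_simple] unfolding chords_def by simp

text \<open>A hub chord makes its outer triangle active without being a cycle edge itself, so the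
  cycle uses the other hub edge of that triangle. This assigns the chords to the at most two used
  hub edges.\<close>

lemma hub_chords_card: "card {e \<in> chords W C. 0 \<in> e} \<le> 2"
proof -
  \<comment> \<open>Swaps the two hub slots of an outer triangle; it is applied to hub slots only,
    so the last case means \<open>s = 9\<close>.\<close>
  define twin :: "nat \<Rightarrow> nat" where
    "twin s = (if s = 5 then 6 else if s = 6 then 5 else if s = 8 then 9 else 8)" for s
  have "{e \<in> chords W C. 0 \<in> e} \<subseteq> (\<lambda>(i, s). {vx i (twin s), 0}) ` hub_used"
  proof
    fix e assume "e \<in> {e \<in> chords W C. 0 \<in> e}"
    then have e: "e \<in> chords W C" "0 \<in> e" by auto
    obtain i s z where b: "i < k" "s < 10" "e = {vx i s, z}"
      using chord_card[OF e(1)] edge_has_vx by blast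
    with e(2) have z: "z = 0" by auto
    with b chord_card[OF e(1)] have s: "s \<in> {5, 6, 8, 9}"
      using edges_vx[OF b(1,2), of z] unfolding hub_slots_def by auto
    have unused: "(i, s) \<notin> hub_used"
      using e(1) b(3) z unfolding chords_def hub_used_def by auto
    have "active i 4" if "s \<in> {5, 6}"
      using outer_active(3)[OF b(1) e(1)] b(3) that by auto
    moreover have "active i 7" if "s \<in> {8, 9}"
      using outer_active(4)[OF b(1) e(1)] b(3) that by auto
    ultimately have "(i, twin s) \<in> hub_used" "twin (twin s) = s"
      using s unused unfolding active_def twin_def by auto
    with b(3) z show "e \<in> (\<lambda>(i, s). {vx i (twin s), 0}) ` hub_used"
      by (intro image_eqI[of _ _ "(i, twin s)"]) auto
  qed
  then have "card {e \<in> chords W C. 0 \<in> e} \<le> card hub_used"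
    using hub_used_card(1) by (rule surj_card_le[rotated])
  with hub_used_card(2) show ?thesis by simp
qed

text \<open>A vertex of degree three lies on at most one chord, so the chords avoiding the hub form a
  matching on the at most 14 vertices near a hub edge of the cycle.\<close>

lemma non_hub_chords_card: "card {e \<in> chords W C. 0 \<notin> e} \<le> 7"
proof -
  let ?M = "{e \<in> chords W C. 0 \<notin> e}"
  have vx: "\<exists>i s. i < k \<and> s < 10 \<and> x = vx i s" if "e \<in> ?M" "x \<in> e" for e x
  proof -
    have "e \<subseteq> verts W" "0 \<notin> e" using that(1) chord_card by simp_all
    with that(2) have "x \<in> verts W" "x \<noteq> 0" by (blast, metis)
    then show ?thesis by (metis vx_cases)
  qed
  have "disjnt e f" if ef: "e \<in> ?M" "f \<in> ?M" "e \<noteq> f" for e f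
  proof (rule ccontr)
    assume "\<not> disjnt e f"
    then obtain x where x: "x \<in> e" "x \<in> f" unfolding disjnt_def by blast
    obtain i s where b: "i < k" "s < 10" "x = vx i s" using vx[OF ef(1) x(1)] by blast
    obtain p q r where pqr: "p \<noteq> q" "p \<noteq> r" "q \<noteq> r" "\<And>z. {x, z} \<in> edges W \<longleftrightarrow> z \<in> {p, q, r}"
      using cubic[OF b(1,2)] b(3) by metis
    have "card e = 2" "card f = 2" using ef chord_card by auto
    with x obtain z z' where zz: "e = {x, z}" "f = {x, z'}"
      by (auto simp: card_2_iff doubleton_eq_iff)
    with ef have "z = z'"
      using cubic_chord_unique[OF C pqr(4,1-3)] by blast
    with zz ef(3) show False by simp
  qed
  then have "card (\<Union> ?M) = sum card ?M"
    using chord_card chords_finite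
    by (intro card_Union_disjoint) (auto simp: pairwise_def intro: card_ge_0_finite)
  also have "\<dots> = 2 * card ?M"
    using chord_card by simp
  finally have "2 * card ?M = card (\<Union> ?M)" by simp
  also have "\<dots> \<le> card (\<Union> (near ` hub_used))"
  proof (rule card_mono)
    show "finite (\<Union> (near ` hub_used))" using hub_used_card(1) card_near(2) by simp
    show "\<Union> ?M \<subseteq> \<Union> (near ` hub_used)"
    proof
      fix x assume "x \<in> \<Union> ?M"
      then obtain e where e: "e \<in> ?M" "x \<in> e" by blast
      obtain i s where b: "i < k" "s < 10" "x = vx i s" using vx[OF e] by blast
      show "x \<in> \<Union> (near ` hub_used)"
        using chord_near[OF b(1,2), of e] e b(3) by simp
    qed
  qed
  also have "\<dots> \<le> (\<Sum>u\<in>hub_used. card (near u))"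
    by (rule card_UN_le) (rule hub_used_card(1))
  also have "\<dots> \<le> (\<Sum>u\<in>hub_used. 7)"
    by (rule sum_mono) (rule card_near(1))
  also have "\<dots> \<le> 14" using hub_used_card(2) by simp
  finally show ?thesis by simp
qed

lemma W_chords: "ch W C \<le> 9"
proof -
  have "chords W C = {e \<in> chords W C. 0 \<in> e} \<union> {e \<in> chords W C. 0 \<notin> e}" by blast
  then have "ch W C \<le> card {e \<in> chords W C. 0 \<in> e} + card {e \<in> chords W C. 0 \<notin> e}"
    unfolding ch_def by (metis card_Un_le)
  with hub_chords_card non_hub_chords_card show ?thesis by linarith
qed

end

end

theorem theorem4p1:
  fixes m :: nat
  assumes "m \<ge> 1"
  shows "\<exists>G :: nat ugraph.
           finite_simple_graph G \<and> card (verts G) = 20 * m + 31 \<and> K_free 4 G \<and>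
           chromatic_number G = 4 \<and>
           (\<forall>H. proper_subgraph H G \<longrightarrow> colorable 3 H \<and> degenerate 2 H) \<and>
           (\<forall>C. subgraph C G \<and> cycle_graph C \<longrightarrow> ch G C \<le> 10)"
proof -
  \<comment> \<open>An odd rim length of at least three, with
    \<open>10 * ?k + 1 = 20 * m + 31\<close> vertices.\<close>
  let ?k = "2 * m + 3"
  have k: "3 \<le> ?k" "odd ?k" by auto
  have "card (verts (triangle_wheel ?k)) = 20 * m + 31"
    unfolding triangle_wheel_def by simp
  moreover have "ch (triangle_wheel ?k) C \<le> 10"
    if "subgraph C (triangle_wheel ?k)" "cycle_graph C" for C
    using W_chords[OF k(1) that] by simp
  ultimately show ?thesis
    using W_simple[OF k(1)] W_K4_free[OF k(1)] W_chromatic_number[OF k] proper_colorable[OF k(1)]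
      proper_degenerate[OF k(1)] by blast
qed

end
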